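(* If $\max\{R_p,R_n\}\le R_0$, then the continuation probabilities $\hat\eta_1,\hat\eta_2\in(0,1]$ that maximise the efficiency $\mathrm{ESS}/T_{\mathrm{tot}}$ (in the limit $N\to\infty$) of the sample $\{w_{\mathrm{mf}}(\theta_i),\theta_i\}$ are equal to $\eta_1^\star,\eta_2^\star\in(0,1]$, where $$(\eta_1^\star,\eta_2^\star)=\left(\sqrt{\frac{R_p}{R_0}},\sqrt{\frac{R_n}{R_0}}\right).$$ Conversely, if $\max\{R_p,R_n\}>R_0$, then at least one of $\eta_1^\star,\eta_2^\star$ is greater than $1$, and the values of $\hat\eta_1,\hat\eta_2\in(0,1]$ that maximise the efficiency $\mathrm{ESS}/T_{\mathrm{tot}}$ (in the limit $N\to\infty$) are $$(\hat\eta_1,\hat\eta_2)=\begin{cases}(1,\bar\eta_2)&\text{if }\phi(1,\bar\eta_2)\le\phi(\bar\eta_1,1),\\(\bar\eta_1,1)&\text{otherwise,}\end{cases}$$ where $$\bar\eta_1=\min\left\{1,\ \eta_1^\star\bigg/\sqrt{\frac{1+p_{fn}/R_0}{1+c_n/\mathbb E(\tilde c)}}\right\},\qquad \bar\eta_2=\min\left\{1,\ \eta_2^\star\bigg/\sqrt{\frac{1+p_{fp}/R_0}{1+c_p/\mathbb E(\tilde c)}}\right\}.$$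
   Context: Setting: $\theta$ is a random parameter with prior distribution $\pi$. Given $\theta$, a pair $(\tilde y,y)$ of (possibly dependent) random simulation outputs is generated, $\tilde y$ from a low-fidelity model at computational cost $\tilde c$, and $y$ from a high-fidelity model at computational cost $c$. $\tilde\Omega$ and $\Omega$ are fixed subsets of the respective output spaces (neighbourhoods of the observed data). $U\sim\mathrm{Unif}(0,1)$ is independent of $(\theta,\tilde y,y,\tilde c,c)$. All probabilities and expectations are with respect to the joint law with $\theta\sim\pi$. Weights: $w=\mathbb I(y\in\Omega)$, $\tilde w=\mathbb I(\tilde y\in\tilde\Omega)$, where $\mathbb I$ denotes the indicator. For constants $\eta_1,\eta_2\in(0,1]$ (continuation probabilities) put $\eta(\tilde y)=\eta_1\mathbb I(\tilde y\in\tilde\Omega)+\eta_2\mathbb I(\tilde y\notin\tilde\Omega)$ and define the multifidelity weight $$w_{\mathrm{mf}}=\tilde w+\frac{\mathbb I(U<\eta(\tilde y))}{\eta(\tilde y)}(w-\tilde w).$$ The high-fidelity model is simulated only when $U<\eta(\tilde y)$, so the time to compute $w_{\mathrm{mf}}$ is $T=\tilde c+\mathbb I(U<\eta(\tilde y))\,c$. The sample $\{w_{\mathrm{mf}}(\theta_i),\theta_i\}_{i=1}^N$ is built from $N$ independent copies of $(\theta,\tilde y,y,\tilde c,c,U)$, with weights $w_i=w_{\mathrm{mf}}(\theta_i)$ and times $T_i$. Its effective sample size is $\mathrm{ESS}=(\sum_iw_i)^2/\sum_iw_i^2$, the total time is $T_{\mathrm{tot}}=\sum_iT_i$, and the efficiency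 is $\mathrm{ESS}/T_{\mathrm{tot}}$, whose limiting value as $N\to\infty$ is $$\frac{\mathbb E(w_{\mathrm{mf}})^2}{\mathbb E(w_{\mathrm{mf}}^2)\,\mathbb E(T)}.$$ Notation: $p_{tp}=\mathbb P(\{\tilde y\in\tilde\Omega\}\cap\{y\in\Omega\})$, $p_{fp}=\mathbb P(\{\tilde y\in\tilde\Omega\}\cap\{y\notin\Omega\})$, $p_{fn}=\mathbb P(\{\tilde y\notin\tilde\Omega\}\cap\{y\in\Omega\})$, $c_p=\mathbb E(c\mid\tilde y\in\tilde\Omega)\,\mathbb P(\tilde y\in\tilde\Omega)$, $c_n=\mathbb E(c\mid\tilde y\notin\tilde\Omega)\,\mathbb P(\tilde y\notin\tilde\Omega)$, $R_p=\dfrac{p_{fp}}{c_p/\mathbb E(\tilde c)}$, $R_n=\dfrac{p_{fn}}{c_n/\mathbb E(\tilde c)}$, $R_0=p_{tp}-p_{fp}$, and $$\phi(\eta_1,\eta_2)=\left((p_{tp}-p_{fp})+\frac{1}{\eta_1}p_{fp}+\frac{1}{\eta_2}p_{fn}\right)\left(\mathbb E(\tilde c)+\eta_1c_p+\eta_2c_n\right),$$ which equals $\mathbb E(w_{\mathrm{mf}}^2)\,\mathbb E(T)$.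
   Formalization: Assumes E(c̃), c_p, c_n, R_0, p_fp, p_fn are all positive: otherwise R_p, R_n or η* is undefined, or (p_fp=0 or p_fn=0) some η* is 0 and no maximiser exists in (0,1]². *)

theory Defs
  imports "HOL-Probability.Probability"
begin

text \<open>
  A single multifidelity draw consists of random variables on the probability space \<open>law\<close>:
  the parameter \<open>param\<close> (with law \<open>prior\<close>), the low- and high-fidelity outputs \<open>lo_out\<close>, \<open>hi_out\<close>,
  their simulation costs \<open>lo_cost\<close>, \<open>hi_cost\<close>, and the uniform variable \<open>unif\<close>.  The sets
  \<open>lo_nbhd\<close>, \<open>hi_nbhd\<close> are the neighbourhoods of the observed data.
\<close>

record ('w, 'p, 'a, 'b) mf_model =
  law :: "'w measure"
  prior :: "'p measure"
  lo_space :: "'a measure"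
  hi_space :: "'b measure"
  param :: "'w \<Rightarrow> 'p"
  lo_out :: "'w \<Rightarrow> 'a"
  hi_out :: "'w \<Rightarrow> 'b"
  lo_cost :: "'w \<Rightarrow> real"
  hi_cost :: "'w \<Rightarrow> real"
  unif :: "'w \<Rightarrow> real"
  lo_nbhd :: "'a set"
  hi_nbhd :: "'b set"

text \<open>
  The joint law of parameter, outputs and costs is arbitrary; in particular the two outputs may be
  dependent given the parameter, and the costs may depend on everything except \<open>unif\<close>.
  Independence of \<open>unif\<close> is stated for the generated \<open>\<sigma>\<close>-algebras, because \<open>indep_var\<close> needs
  both variables to have the same type.
\<close>

definition mf_setting :: "('w, 'p, 'a, 'b) mf_model \<Rightarrow> bool" where
  "mf_setting S \<longleftrightarrow>
     prob_space (law S) \<and>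
     param S \<in> law S \<rightarrow>\<^sub>M prior S \<and> distr (law S) (prior S) (param S) = prior S \<and>
     lo_out S \<in> law S \<rightarrow>\<^sub>M lo_space S \<and> lo_nbhd S \<in> sets (lo_space S) \<and>
     hi_out S \<in> law S \<rightarrow>\<^sub>M hi_space S \<and> hi_nbhd S \<in> sets (hi_space S) \<and>
     integrable (law S) (lo_cost S) \<and> (AE \<omega> in law S. 0 \<le> lo_cost S \<omega>) \<and>
     integrable (law S) (hi_cost S) \<and> (AE \<omega> in law S. 0 \<le> hi_cost S \<omega>) \<and>
     unif S \<in> borel_measurable (law S) \<and>
     distr (law S) borel (unif S) = uniform_measure lborel {0<..<1} \<and>
     prob_space.indep_set (law S)
       {(\<lambda>\<omega>. (param S \<omega>, lo_out S \<omega>, hi_out S \<omega>, lo_cost S \<omega>, hi_cost S \<omega>)) -` A \<inter> space (law S) | A.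
          A \<in> sets (prior S \<Otimes>\<^sub>M lo_space S \<Otimes>\<^sub>M hi_space S \<Otimes>\<^sub>M borel \<Otimes>\<^sub>M borel)}
       {unif S -` B \<inter> space (law S) | B. B \<in> sets borel}"

definition hi_weight :: "('w, 'p, 'a, 'b) mf_model \<Rightarrow> 'w \<Rightarrow> real" where
  "hi_weight S \<omega> = indicator (hi_nbhd S) (hi_out S \<omega>)"

definition lo_weight :: "('w, 'p, 'a, 'b) mf_model \<Rightarrow> 'w \<Rightarrow> real" where
  "lo_weight S \<omega> = indicator (lo_nbhd S) (lo_out S \<omega>)"

definition cont_prob :: "('w, 'p, 'a, 'b) mf_model \<Rightarrow> real \<Rightarrow> real \<Rightarrow> 'w \<Rightarrow> real" where
  "cont_prob S \<eta>1 \<eta>2 \<omega> =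
     \<eta>1 * indicator (lo_nbhd S) (lo_out S \<omega>) + \<eta>2 * indicator (- lo_nbhd S) (lo_out S \<omega>)"

definition mf_weight :: "('w, 'p, 'a, 'b) mf_model \<Rightarrow> real \<Rightarrow> real \<Rightarrow> 'w \<Rightarrow> real" where
  "mf_weight S \<eta>1 \<eta>2 \<omega> =
     lo_weight S \<omega> +
     of_bool (unif S \<omega> < cont_prob S \<eta>1 \<eta>2 \<omega>) / cont_prob S \<eta>1 \<eta>2 \<omega> *
       (hi_weight S \<omega> - lo_weight S \<omega>)"

definition mf_time :: "('w, 'p, 'a, 'b) mf_model \<Rightarrow> real \<Rightarrow> real \<Rightarrow> 'w \<Rightarrow> real" where
  "mf_time S \<eta>1 \<eta>2 \<omega> =
     lo_cost S \<omega> + of_bool (unif S \<omega> < cont_prob S \<eta>1 \<eta>2 \<omega>) * hi_cost S \<omega>"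

text \<open>
  An infinite sequence of independent copies of the draw is a point \<open>x\<close> of the product space
  below, the \<open>i\<close>-th copy being evaluated at \<open>x i\<close>; a sample of size \<open>N\<close> uses the copies \<open>i < N\<close>.
\<close>

definition sample_space :: "('w, 'p, 'a, 'b) mf_model \<Rightarrow> (nat \<Rightarrow> 'w) measure" where
  "sample_space S = (\<Pi>\<^sub>M i\<in>(UNIV :: nat set). law S)"

definition ESS ::
  "('w, 'p, 'a, 'b) mf_model \<Rightarrow> real \<Rightarrow> real \<Rightarrow> nat \<Rightarrow> (nat \<Rightarrow> 'w) \<Rightarrow> real" where
  "ESS S \<eta>1 \<eta>2 N x =
     (\<Sum>i<N. mf_weight S \<eta>1 \<eta>2 (x i))\<^sup>2 / (\<Sum>i<N. (mf_weight S \<eta>1 \<eta>2 (x i))\<^sup>2)"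

definition total_time ::
  "('w, 'p, 'a, 'b) mf_model \<Rightarrow> real \<Rightarrow> real \<Rightarrow> nat \<Rightarrow> (nat \<Rightarrow> 'w) \<Rightarrow> real" where
  "total_time S \<eta>1 \<eta>2 N x = (\<Sum>i<N. mf_time S \<eta>1 \<eta>2 (x i))"

definition has_limiting_efficiency ::
  "('w, 'p, 'a, 'b) mf_model \<Rightarrow> real \<Rightarrow> real \<Rightarrow> real \<Rightarrow> bool" where
  "has_limiting_efficiency S \<eta>1 \<eta>2 L \<longleftrightarrow>
     (AE x in sample_space S. (\<lambda>N. ESS S \<eta>1 \<eta>2 N x / total_time S \<eta>1 \<eta>2 N x) \<longlonglongrightarrow> L)"

text \<open>
  Membership below requires the limiting efficiency to exist at every admissible pair, so a
  competitor cannot be discarded for want of a limit.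
\<close>

definition efficiency_maximisers :: "('w, 'p, 'a, 'b) mf_model \<Rightarrow> (real \<times> real) set" where
  "efficiency_maximisers S =
     {(\<eta>1, \<eta>2). \<eta>1 \<in> {0<..1} \<and> \<eta>2 \<in> {0<..1} \<and>
        (\<exists>L. has_limiting_efficiency S \<eta>1 \<eta>2 L \<and>
           (\<forall>\<zeta>1\<in>{0<..1}. \<forall>\<zeta>2\<in>{0<..1}. \<exists>L'. has_limiting_efficiency S \<zeta>1 \<zeta>2 L' \<and> L' \<le> L))}"

definition lo_pos :: "('w, 'p, 'a, 'b) mf_model \<Rightarrow> 'w set" where
  "lo_pos S = {\<omega> \<in> space (law S). lo_out S \<omega> \<in> lo_nbhd S}"

definition lo_neg :: "('w, 'p, 'a, 'b) mf_model \<Rightarrow> 'w set" where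
  "lo_neg S = {\<omega> \<in> space (law S). lo_out S \<omega> \<notin> lo_nbhd S}"

definition hi_pos :: "('w, 'p, 'a, 'b) mf_model \<Rightarrow> 'w set" where
  "hi_pos S = {\<omega> \<in> space (law S). hi_out S \<omega> \<in> hi_nbhd S}"

definition hi_neg :: "('w, 'p, 'a, 'b) mf_model \<Rightarrow> 'w set" where
  "hi_neg S = {\<omega> \<in> space (law S). hi_out S \<omega> \<notin> hi_nbhd S}"

definition p_tp :: "('w, 'p, 'a, 'b) mf_model \<Rightarrow> real" where
  "p_tp S = measure (law S) (lo_pos S \<inter> hi_pos S)"

definition p_fp :: "('w, 'p, 'a, 'b) mf_model \<Rightarrow> real" where
  "p_fp S = measure (law S) (lo_pos S \<inter> hi_neg S)"

definition p_fn :: "('w, 'p, 'a, 'b) mf_model \<Rightarrow> real" where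
  "p_fn S = measure (law S) (lo_neg S \<inter> hi_pos S)"

text \<open>
  \<open>uniform_measure M A\<close> is the conditional probability measure of \<open>M\<close> given the event \<open>A\<close>, so the
  integrals below are conditional expectations given an event.
\<close>

definition c_p :: "('w, 'p, 'a, 'b) mf_model \<Rightarrow> real" where
  "c_p S = (\<integral>\<omega>. hi_cost S \<omega> \<partial>uniform_measure (law S) (lo_pos S)) * measure (law S) (lo_pos S)"

definition c_n :: "('w, 'p, 'a, 'b) mf_model \<Rightarrow> real" where
  "c_n S = (\<integral>\<omega>. hi_cost S \<omega> \<partial>uniform_measure (law S) (lo_neg S)) * measure (law S) (lo_neg S)"

definition mean_lo_cost :: "('w, 'p, 'a, 'b) mf_model \<Rightarrow> real" where
  "mean_lo_cost S = (\<integral>\<omega>. lo_cost S \<omega> \<partial>law S)"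

definition R_p :: "('w, 'p, 'a, 'b) mf_model \<Rightarrow> real" where
  "R_p S = p_fp S / (c_p S / mean_lo_cost S)"

definition R_n :: "('w, 'p, 'a, 'b) mf_model \<Rightarrow> real" where
  "R_n S = p_fn S / (c_n S / mean_lo_cost S)"

definition R_0 :: "('w, 'p, 'a, 'b) mf_model \<Rightarrow> real" where
  "R_0 S = p_tp S - p_fp S"

definition phi :: "('w, 'p, 'a, 'b) mf_model \<Rightarrow> real \<Rightarrow> real \<Rightarrow> real" where
  "phi S \<eta>1 \<eta>2 =
     ((p_tp S - p_fp S) + 1 / \<eta>1 * p_fp S + 1 / \<eta>2 * p_fn S) *
     (mean_lo_cost S + \<eta>1 * c_p S + \<eta>2 * c_n S)"

definition eta1_star :: "('w, 'p, 'a, 'b) mf_model \<Rightarrow> real" where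
  "eta1_star S = sqrt (R_p S / R_0 S)"

definition eta2_star :: "('w, 'p, 'a, 'b) mf_model \<Rightarrow> real" where
  "eta2_star S = sqrt (R_n S / R_0 S)"

definition eta1_bar :: "('w, 'p, 'a, 'b) mf_model \<Rightarrow> real" where
  "eta1_bar S =
     min 1 (eta1_star S / sqrt ((1 + p_fn S / R_0 S) / (1 + c_n S / mean_lo_cost S)))"

definition eta2_bar :: "('w, 'p, 'a, 'b) mf_model \<Rightarrow> real" where
  "eta2_bar S =
     min 1 (eta2_star S / sqrt ((1 + p_fp S / R_0 S) / (1 + c_p S / mean_lo_cost S)))"

end

theory Submission
  imports Defs "HOL-Real_Asymp.Real_Asymp"
begin

text \<open>
  By the strong law of large numbers the limiting efficiency exists almost surely and equals
  \<open>(p\<^sub>t\<^sub>p + p\<^sub>f\<^sub>n)\<^sup>2 / phi\<close>, so maximising it means minimising \<open>phi\<close> over \<open>(0,1]\<^sup>2\<close>.  The costs are only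
  integrable; the strong law is obtained from Garsia's maximal ergodic inequality, applied on the shift
  invariant event that the partial sums drift upwards, which is independent of the first coordinate.

  Completing squares in the expanded product shows that \<open>(\<eta>\<^sub>1\<^sup>\<star>, \<eta>\<^sub>2\<^sup>\<star>)\<close> is the unique minimiser of \<open>phi\<close> on
  the positive quadrant.  As \<open>phi\<close> is strictly convex in logarithmic coordinates, when this point lies
  outside the box the segment towards it decreases \<open>phi\<close> until it hits an edge \<open>\<eta>\<^sub>1 = 1\<close> or \<open>\<eta>\<^sub>2 = 1\<close>, where
  the minimum is one-dimensional; strict convexity also makes the minimiser unique when both edges tie.
\<close>

section \<open>The strong law of large numbers\<close>

text \<open>
  Equivalently \<open>limsup (S\<^sub>n / n) > 0\<close> for the partial sums \<open>S\<^sub>n\<close>, spelled out to avoid extended reals.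
\<close>

definition drifting_up :: "('w \<Rightarrow> real) \<Rightarrow> (nat \<Rightarrow> 'w) \<Rightarrow> bool" where
  "drifting_up X x \<longleftrightarrow> (\<exists>j::nat. \<exists>\<^sub>F n in sequentially. real n / real (Suc j) \<le> (\<Sum>i<n. X (x i)))"

text \<open>Dropping the first term changes the partial sum by a constant and the index by one.
  Weakening the slope from \<open>1 / Suc j\<close> to \<open>1 / Suc (Suc j)\<close> absorbs both,
  which is why the definition quantifies over \<open>j\<close>.\<close>

lemma drifting_up_tail: "drifting_up X (\<lambda>i. x (Suc i)) \<longleftrightarrow> drifting_up X x"
proof
  assume "drifting_up X x"
  then obtain j where j: "\<exists>\<^sub>F n in sequentially. real n / real (Suc j) \<le> (\<Sum>i<n. X (x i))"
    by (auto simp: drifting_up_def)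
  have "\<exists>\<^sub>F n in sequentially. real (Suc n) / real (Suc j) \<le> (\<Sum>i<Suc n. X (x i))"
    using j unfolding frequently_def
    by (subst eventually_sequentially_Suc[of "\<lambda>n. \<not> real n / real (Suc j) \<le> (\<Sum>i<n. X (x i))"])
  moreover have "\<forall>\<^sub>F n in sequentially. real (Suc n) / real (Suc j) - X (x 0) \<ge> real n / real (Suc (Suc j))"
    by real_asymp
  ultimately have "\<exists>\<^sub>F n in sequentially. real (Suc n) / real (Suc j) \<le> (\<Sum>i<Suc n. X (x i))
      \<and> real (Suc n) / real (Suc j) - X (x 0) \<ge> real n / real (Suc (Suc j))"
    by (rule frequently_eventually_frequently)
  then have "\<exists>\<^sub>F n in sequentially. real n / real (Suc (Suc j)) \<le> (\<Sum>i<n. X (x (Suc i)))"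
    by (rule frequently_elim1) (auto simp: sum.lessThan_Suc_shift simp del: sum.lessThan_Suc)
  then show "drifting_up X (\<lambda>i. x (Suc i))" unfolding drifting_up_def by blast
next
  assume "drifting_up X (\<lambda>i. x (Suc i))"
  then obtain j where j: "\<exists>\<^sub>F n in sequentially. real n / real (Suc j) \<le> (\<Sum>i<n. X (x (Suc i)))"
    by (auto simp: drifting_up_def)
  have E: "\<forall>\<^sub>F n in sequentially. real n / real (Suc j) + X (x 0) \<ge> real (Suc n) / real (Suc (Suc j))"
    by real_asymp
  have "\<exists>\<^sub>F n in sequentially. real (Suc n) / real (Suc (Suc j)) \<le> (\<Sum>i<Suc n. X (x i))"
    using frequently_eventually_frequently[OF j E]
    by (rule frequently_elim1) (auto simp: sum.lessThan_Suc_shift simp del: sum.lessThan_Suc)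
  then have "\<exists>\<^sub>F n in sequentially. real n / real (Suc (Suc j)) \<le> (\<Sum>i<n. X (x i))"
    unfolding frequently_def
    by (subst (asm) eventually_sequentially_Suc[of "\<lambda>n. \<not> real n / real (Suc (Suc j)) \<le> (\<Sum>i<n. X (x i))"])
  then show "drifting_up X x" unfolding drifting_up_def by blast
qed


lemma measurable_drifting_up [measurable]:
  assumes [measurable]: "X \<in> borel_measurable M"
  shows "Measurable.pred (\<Pi>\<^sub>M i\<in>(UNIV :: nat set). M) (drifting_up X)"
  unfolding drifting_up_def[abs_def] frequently_sequentially by measurable

section \<open>The shift on the infinite product space\<close>

context sequence_space
begin

lemma measurable_shift [measurable]: "(\<lambda>x i. x (Suc i)) \<in> S \<rightarrow>\<^sub>M S"
  by (rule measurable_PiM_single') (auto simp: space_PiM)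

lemma distr_shift: "distr S S (\<lambda>x i. x (Suc i)) = S"
  using distr_PiM_reindex[of UNIV "\<lambda>_. M" Suc "UNIV :: nat set"] M.prob_space_axioms by (simp add: restrict_UNIV)

lemma integral_shift:
  fixes f :: "(nat \<Rightarrow> 'a) \<Rightarrow> real"
  assumes [measurable]: "f \<in> borel_measurable S"
  shows "(\<integral>x. f (\<lambda>i. x (Suc i)) \<partial>S) = (\<integral>x. f x \<partial>S)"
  by (subst (2) distr_shift[symmetric]) (simp add: integral_distr)

lemma integrable_shift:
  fixes f :: "(nat \<Rightarrow> 'a) \<Rightarrow> real"
  assumes "integrable S f"
  shows "integrable S (\<lambda>x. f (\<lambda>i. x (Suc i)))"
  using assms by (subst (asm) distr_shift[symmetric]) (auto dest: integrable_distr[rotated])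

lemma integrable_component:
  fixes X :: "'a \<Rightarrow> real"
  assumes "integrable M X"
  shows "integrable S (\<lambda>x. X (x i))"
  using assms PiM_component[of i] by (metis UNIV_I integrable_distr measurable_component_singleton)

text \<open>A property unaffected by prepending a term does not see the first coordinate. Splitting
  a sequence into head and tail via \<open>PiM_iter\<close> turns the integral into a double one,
  which Fubini factors.\<close>

lemma integral_component_shift_invariant:
  fixes X :: "'a \<Rightarrow> real"
  assumes X: "integrable M X" and P [measurable]: "Measurable.pred S P"
    and inv: "\<And>s x. P (case_nat s x) \<longleftrightarrow> P x"
  shows "(\<integral>x. of_bool (P x) * X (x 0) \<partial>S) = (\<integral>s. X s \<partial>M) * measure S {x \<in> space S. P x}"
proof -
  note [measurable] = borel_measurable_integrable[OF X]
  interpret MS: pair_prob_space M S ..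
  have int: "integrable S (\<lambda>x. of_bool (P x) * X (x 0))"
    by (rule Bochner_Integration.integrable_bound[OF integrable_component[OF X, of 0]]) auto
  have int2: "integrable (M \<Otimes>\<^sub>M S) (\<lambda>(s, x). of_bool (P x) * X s)"
    using int by (subst (asm) PiM_iter[symmetric]) (auto dest!: integrable_distr[rotated] simp: inv case_prod_unfold)
  have "(\<integral>x. of_bool (P x) * X (x 0) \<partial>S) = (\<integral>(s, x). of_bool (P x) * X s \<partial>(M \<Otimes>\<^sub>M S))"
    by (subst PiM_iter[symmetric]) (simp add: integral_distr case_prod_unfold inv)
  also have "\<dots> = (\<integral>s. (\<integral>x. of_bool (P x) * X s \<partial>S) \<partial>M)"
    using MS.integral_fst'[OF int2] by simp
  also have "\<dots> = (\<integral>s. X s \<partial>M) * (\<integral>x. of_bool (P x) \<partial>S)"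
    by simp
  also have "(\<integral>x. of_bool (P x) \<partial>S) = measure S {x \<in> space S. P x}"
    by (subst Bochner_Integration.integral_cong[OF refl, of _ _ "indicator {x \<in> space S. P x}"])
      (auto simp: indicator_def)
  finally show ?thesis .
qed


text \<open>
  The maximum of \<open>0\<close> and the first \<open>n\<close> partial sums, with the recursion that drives Garsia's proof of
  the maximal ergodic inequality.
\<close>

primrec run_max :: "('a \<Rightarrow> real) \<Rightarrow> nat \<Rightarrow> (nat \<Rightarrow> 'a) \<Rightarrow> real" where
  "run_max X 0 x = 0"
| "run_max X (Suc n) x = max 0 (X (x 0) + run_max X n (\<lambda>i. x (Suc i)))"

lemma run_max_nonneg: "0 \<le> run_max X n x"
  by (cases n) auto

lemma run_max_mono: "run_max X n x \<le> run_max X (Suc n) x"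
proof (induction n arbitrary: x)
  case (Suc n)
  from Suc[of "\<lambda>i. x (Suc i)"] show ?case by auto
qed simp

lemma sum_le_run_max: "(\<Sum>i<n. X (x i)) \<le> run_max X n x"
proof (induction n arbitrary: x)
  case (Suc n)
  from Suc[of "\<lambda>i. x (Suc i)"] show ?case
    by (simp add: sum.lessThan_Suc_shift del: sum.lessThan_Suc)
qed simp

lemma integrable_run_max:
  assumes "integrable M X"
  shows "integrable S (run_max X n)"
proof (induction n)
  case (Suc n)
  have "integrable S (\<lambda>x. max 0 (X (x 0) + run_max X n (\<lambda>i. x (Suc i))))"
    by (intro Bochner_Integration.integrable_max Bochner_Integration.integrable_add
      integrable_component assms integrable_shift Suc) simp
  then show ?case by simp
qed simp

text \<open>Where \<open>run_max X (Suc n)\<close> is positive it equals \<open>X (x 0)\<close> plus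
  \<open>run_max X n\<close> of the shifted sequence; elsewhere it is 0, at most the latter alone.
  The shift preserves \<open>S\<close> and the event \<open>P\<close>, so the two integrals of
  \<open>run_max X n\<close> cancel.\<close>

lemma maximal_ergodic_inequality:
  assumes X: "integrable M X" and P [measurable]: "Measurable.pred S P"
    and inv: "\<And>x. P (\<lambda>i. x (Suc i)) \<longleftrightarrow> P x"
  shows "0 \<le> (\<integral>x. of_bool (P x \<and> 0 < run_max X (Suc n) x) * X (x 0) \<partial>S)"
proof -
  note int = integrable_run_max[OF X]
  note [measurable] = borel_measurable_integrable[OF X] borel_measurable_integrable[OF int]
  have int_P: "integrable S (\<lambda>x. of_bool (P x) * run_max X k x)" for k
    by (rule Bochner_Integration.integrable_bound[OF int[of k]]) (auto simp del: run_max.simps)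
  have int_shift: "integrable S (\<lambda>x. of_bool (P x) * run_max X n (\<lambda>i. x (Suc i)))"
    using integrable_shift[OF int_P[of n]] by (simp add: inv)
  have int_X: "integrable S (\<lambda>x. of_bool (P x \<and> 0 < run_max X (Suc n) x) * X (x 0))"
    by (rule Bochner_Integration.integrable_bound[OF integrable_component[OF X, of 0]])
      (auto simp del: run_max.simps)
  have "(\<integral>x. of_bool (P x) * run_max X n x \<partial>S) \<le> (\<integral>x. of_bool (P x) * run_max X (Suc n) x \<partial>S)"
    by (intro integral_mono int_P mult_left_mono run_max_mono) auto
  also have "\<dots> \<le> (\<integral>x. of_bool (P x \<and> 0 < run_max X (Suc n) x) * X (x 0)
      + of_bool (P x) * run_max X n (\<lambda>i. x (Suc i)) \<partial>S)"
  proof (intro integral_mono int_P Bochner_Integration.integrable_add int_X int_shift)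
    fix x
    show "of_bool (P x) * run_max X (Suc n) x \<le> of_bool (P x \<and> 0 < run_max X (Suc n) x) * X (x 0)
      + of_bool (P x) * run_max X n (\<lambda>i. x (Suc i))"
      using run_max_nonneg[of X n "\<lambda>i. x (Suc i)"] by (auto simp: max_def)
  qed
  also have "\<dots> = (\<integral>x. of_bool (P x \<and> 0 < run_max X (Suc n) x) * X (x 0) \<partial>S)
      + (\<integral>x. of_bool (P x) * run_max X n (\<lambda>i. x (Suc i)) \<partial>S)"
    by (rule Bochner_Integration.integral_add[OF int_X int_shift])
  also have "(\<integral>x. of_bool (P x) * run_max X n (\<lambda>i. x (Suc i)) \<partial>S) = (\<integral>x. of_bool (P x) * run_max X n x \<partial>S)"
    using integral_shift[of "\<lambda>x. of_bool (P x) * run_max X n x"] by (simp add: inv)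
  finally show ?thesis by simp
qed

text \<open>On the drifting event some partial sum is positive, so letting \<open>n\<close> grow
  removes the side condition from the maximal inequality. The resulting nonnegative integral is the
  negative mean times the probability of the event, which must therefore be 0.\<close>

lemma AE_not_drifting_up:
  assumes X: "integrable M X" and neg: "(\<integral>s. X s \<partial>M) < 0"
  shows "AE x in S. \<not> drifting_up X x"
proof -
  note [measurable] = borel_measurable_integrable[OF X] borel_measurable_integrable[OF integrable_run_max[OF X]]
  have pos: "\<forall>\<^sub>F n in sequentially. 0 < run_max X (Suc n) x" if "drifting_up X x" for x
  proof -
    from that obtain j where "\<exists>\<^sub>F n in sequentially. real n / real (Suc j) \<le> (\<Sum>i<n. X (x i))"
      by (auto simp: drifting_up_def)
    \<comment> \<open>Index 0 is excluded because there the inequality reads 0 \<le> 0 and gives no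
      positive sum.\<close>
    then obtain n where n: "n \<ge> 1" "real n / real (Suc j) \<le> (\<Sum>i<n. X (x i))"
      by (auto simp: frequently_sequentially)
    have "0 < real n / real (Suc j)" using n(1) by simp
    then have "0 < run_max X n x" using n(2) sum_le_run_max[of X x n] by linarith
    moreover have "run_max X n x \<le> run_max X (Suc k) x" if "k \<ge> n" for k
      by (rule lift_Suc_mono_le[of "\<lambda>n. run_max X n x", OF run_max_mono]) (use that in simp)
    ultimately show ?thesis unfolding eventually_sequentially by (meson less_le_trans)
  qed
  have lim: "(\<lambda>n. \<integral>x. of_bool (drifting_up X x \<and> 0 < run_max X (Suc n) x) * X (x 0) \<partial>S)
      \<longlonglongrightarrow> (\<integral>x. of_bool (drifting_up X x) * X (x 0) \<partial>S)"
  proof (rule integral_dominated_convergence[where w = "\<lambda>x. \<bar>X (x 0)\<bar>"])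
    show "AE x in S. (\<lambda>n. of_bool (drifting_up X x \<and> 0 < run_max X (Suc n) x) * X (x 0))
        \<longlonglongrightarrow> of_bool (drifting_up X x) * X (x 0)"
    proof (rule AE_I2)
      fix x
      show "(\<lambda>n. of_bool (drifting_up X x \<and> 0 < run_max X (Suc n) x) * X (x 0))
          \<longlonglongrightarrow> of_bool (drifting_up X x) * X (x 0)"
      proof (cases "drifting_up X x")
        case True
        from pos[OF True] have "\<forall>\<^sub>F n in sequentially.
          of_bool (drifting_up X x \<and> 0 < run_max X (Suc n) x) * X (x 0) = of_bool (drifting_up X x) * X (x 0)"
          by eventually_elim (simp add: True del: run_max.simps)
        then show ?thesis by (rule tendsto_eventually)
      qed simp
    qed
    show "integrable S (\<lambda>x. \<bar>X (x 0)\<bar>)" by (intro integrable_abs integrable_component X)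
  qed (auto simp del: run_max.simps)
  have "0 \<le> (\<integral>x. of_bool (drifting_up X x) * X (x 0) \<partial>S)"
    by (rule LIMSEQ_le_const[OF lim], rule exI[of _ 0],
        intro allI impI maximal_ergodic_inequality X drifting_up_tail) measurable
  also have "\<dots> = (\<integral>s. X s \<partial>M) * measure S {x \<in> space S. drifting_up X x}"
    by (rule integral_component_shift_invariant[OF X])
      (use drifting_up_tail[of X "case_nat _ _"] in auto)
  finally have "measure S {x \<in> space S. drifting_up X x} \<le> 0"
    using neg by (simp add: zero_le_mult_iff)
  then have "measure S {x \<in> space S. drifting_up X x} = 0" by (simp add: measure_le_0_iff)
  then show ?thesis by (subst (asm) P.prob_eq_0) auto
qed

theorem strong_law_of_large_numbers:
  assumes X: "integrable M X"
  shows "AE x in S. (\<lambda>n. (\<Sum>i<n. X (x i)) / real n) \<longlonglongrightarrow> (\<integral>s. X s \<partial>M)"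
proof -
  define \<mu> where "\<mu> = (\<integral>s. X s \<partial>M)"
  \<comment> \<open>The offset \<open>1 / Suc k\<close> makes the mean strictly negative. With
    \<open>j = k\<close> in \<open>drifting_up\<close>, the offset sums are eventually below
    \<open>n / Suc k\<close>, so the deviation from \<open>n * \<mu>\<close> is eventually below
    \<open>2 * n / Suc k\<close>.\<close>
  have "AE x in S. \<not> drifting_up (\<lambda>s. X s - \<mu> - 1 / real (Suc k)) x" for k
    by (rule AE_not_drifting_up) (use X in \<open>auto simp: \<mu>_def M.prob_space\<close>)
  moreover have "AE x in S. \<not> drifting_up (\<lambda>s. \<mu> - X s - 1 / real (Suc k)) x" for k
    by (rule AE_not_drifting_up) (use X in \<open>auto simp: \<mu>_def M.prob_space\<close>)
  ultimately have "AE x in S. \<forall>k. \<not> drifting_up (\<lambda>s. X s - \<mu> - 1 / real (Suc k)) x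
      \<and> \<not> drifting_up (\<lambda>s. \<mu> - X s - 1 / real (Suc k)) x"
    by (auto simp: AE_all_countable)
  then show ?thesis
  proof eventually_elim
    case (elim x)
    show ?case unfolding \<mu>_def[symmetric]
    proof (rule tendstoI)
      fix e :: real assume "0 < e"
      then obtain k where k: "1 / real (Suc k) < e / 2"
        using nat_approx_posE[of "e / 2"] by auto
      have "\<forall>\<^sub>F n in sequentially. (\<Sum>i<n. X (x i) - \<mu> - 1 / real (Suc k)) < real n / real (Suc k)"
        "\<forall>\<^sub>F n in sequentially. (\<Sum>i<n. \<mu> - X (x i) - 1 / real (Suc k)) < real n / real (Suc k)"
        using elim by (auto simp: drifting_up_def frequently_def not_le)
      then show "\<forall>\<^sub>F n in sequentially. dist ((\<Sum>i<n. X (x i)) / real n) \<mu> < e"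
        using eventually_gt_at_top[of 0]
      proof eventually_elim
        case (elim n)
        define s where "s = (\<Sum>i<n. X (x i))"
        have "(\<Sum>i<n. X (x i) - \<mu> - 1 / real (Suc k)) = s - real n * \<mu> - real n / real (Suc k)"
          "(\<Sum>i<n. \<mu> - X (x i) - 1 / real (Suc k)) = real n * \<mu> - s - real n / real (Suc k)"
          by (simp_all add: sum_subtractf s_def)
        with elim(1,2) have "\<bar>s - real n * \<mu>\<bar> < real n * (2 * (1 / real (Suc k)))"
          by simp
        also have "\<dots> < real n * e" using k elim(3) by (intro mult_strict_left_mono) auto
        finally have "\<bar>s - real n * \<mu>\<bar> / real n < e" using elim(3) by (simp add: divide_less_eq mult.commute)
        moreover have "s / real n - \<mu> = (s - real n * \<mu>) / real n"
          using elim(3) by (simp add: diff_divide_distrib)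
        ultimately show ?case by (simp add: dist_real_def s_def abs_divide)
      qed
    qed
  qed
qed

end

section \<open>Minimising the product of second moment and cost\<close>

text \<open>
  This is \<open>phi\<close> with \<open>r = R\<^sub>0\<close>, \<open>a = p\<^sub>f\<^sub>p\<close>, \<open>b = p\<^sub>f\<^sub>n\<close>, \<open>m = E(lo_cost)\<close>, \<open>c = c\<^sub>p\<close>, \<open>d = c\<^sub>n\<close>.
\<close>

definition cost_prod :: "real \<Rightarrow> real \<Rightarrow> real \<Rightarrow> real \<Rightarrow> real \<Rightarrow> real \<Rightarrow> real \<Rightarrow> real \<Rightarrow> real" where
  "cost_prod r a b m c d x y = (r + a / x + b / y) * (m + c * x + d * y)"

text \<open>The nonconstant monomials come in reciprocal pairs, suited to AM-GM, and each is the
  exponential of a linear form in \<open>ln x\<close> and \<open>ln y\<close>.\<close>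

lemma cost_prod_expand:
  assumes "x > 0" "y > 0"
  shows "cost_prod r a b m c d x y =
    (r*m + a*c + b*d) + r*c * x + a*m * (1/x) + r*d * y + b*m * (1/y) + b*c * (x/y) + a*d * (y/x)"
  using assms unfolding cost_prod_def by (simp add: divide_simps) algebra

lemma sum_to_amgm_min:
  fixes z z0 :: real
  assumes "0 < z" "0 < z0"
  shows "z + z0\<^sup>2 / z = 2 * z0 + (z - z0)\<^sup>2 / z"
  using assms by (simp add: field_simps power2_eq_square)

text \<open>The equations for \<open>X\<close> and \<open>Y\<close> force
  \<open>a * d = b * c * (X / Y)\<^sup>2\<close>, so all three reciprocal pairs attain their AM-GM
  minima at the same point. The excess is a sum of three weighted squares, the first two of which
  vanish together only at \<open>(X, Y)\<close>.\<close>

lemma cost_prod_gt_star: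
  assumes pos: "0 < r" "0 < a" "0 < b" "0 < m" "0 < c" "0 < d" "0 < x" "0 < y" "0 < X" "0 < Y"
    and X: "r * c * X\<^sup>2 = a * m" and Y: "r * d * Y\<^sup>2 = b * m"
    and ne: "(x, y) \<noteq> (X, Y)"
  shows "cost_prod r a b m c d X Y < cost_prod r a b m c d x y"
proof -
  define q where "q = X / Y"
  have q: "0 < q" unfolding q_def using pos by simp
  have a: "a = r * c * X\<^sup>2 / m" and b: "b = r * d * Y\<^sup>2 / m"
    using X Y pos by (auto simp: field_simps)
  have ad: "a * d = b * c * q\<^sup>2" unfolding a b q_def using pos by (simp add: field_simps power_divide)
  have eq: "cost_prod r a b m c d x y =
      (r*m + a*c + b*d) + r*c * (x + X\<^sup>2 / x) + r*d * (y + Y\<^sup>2 / y) + b*c * (x/y + q\<^sup>2 / (x/y))"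
    if "0 < x" "0 < y" for x y
    unfolding cost_prod_expand[OF that] X[symmetric] Y[symmetric] ad by (simp add: algebra_simps)
  have "cost_prod r a b m c d x y - cost_prod r a b m c d X Y =
      r*c * ((x - X)\<^sup>2 / x) + r*d * ((y - Y)\<^sup>2 / y) + b*c * ((x/y - q)\<^sup>2 / (x/y))"
    unfolding eq[OF \<open>0 < x\<close> \<open>0 < y\<close>] eq[OF \<open>0 < X\<close> \<open>0 < Y\<close>]
    using sum_to_amgm_min[of x X] sum_to_amgm_min[of y Y] sum_to_amgm_min[of "x/y" q]
      sum_to_amgm_min[of X X] sum_to_amgm_min[of Y Y] sum_to_amgm_min[of "X/Y" q] q pos
    by (simp add: q_def[symmetric] algebra_simps)
  moreover have "0 < r*c * ((x - X)\<^sup>2 / x) + r*d * ((y - Y)\<^sup>2 / y)"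
  proof (cases "x = X")
    case True
    then have "y \<noteq> Y" using ne by auto
    then show ?thesis using True pos by simp
  next
    case False
    then show ?thesis using pos by (intro add_pos_nonneg) auto
  qed
  moreover have "0 \<le> b*c * ((x/y - q)\<^sup>2 / (x/y))" using pos by simp
  ultimately show ?thesis by linarith
qed

text \<open>Up to a constant the product is a multiple of \<open>t + y0\<^sup>2 / t\<close>, which
  decreases before \<open>y0\<close> and increases after it, so cutting \<open>y0\<close> off at 1
  gives the minimiser.\<close>

lemma edge_min:
  fixes P Q b d y y0 :: real
  assumes pos: "0 < P" "0 < Q" "0 < b" "0 < d" "0 < y0" and y: "0 < y" "y \<le> 1"
    and y0: "P * d * y0\<^sup>2 = b * Q" and ne: "y \<noteq> min 1 y0"
  shows "(P + b / min 1 y0) * (Q + d * min 1 y0) < (P + b / y) * (Q + d * y)"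
proof -
  define z where "z = min 1 y0"
  have z: "0 < z" using pos by (simp add: z_def)
  have e: "(P + b / t) * (Q + d * t) = P * Q + b * d + P * d * (t + y0\<^sup>2 / t)" if "0 < t" for t
    using that y0 by (simp add: field_simps)
  have diff: "(P + b / y) * (Q + d * y) - (P + b / z) * (Q + d * z) = P * d * ((y - z) * (y * z - y0\<^sup>2) / (y * z))"
    unfolding e[OF y(1)] e[OF z] using y z by (simp add: field_simps power2_eq_square)
  \<comment> \<open>If the cut is inactive this is \<open>y0\<close> times a square; otherwise both
    factors are negative.\<close>
  have "0 < (y - z) * (y * z - y0\<^sup>2)"
  proof (cases "y0 \<le> 1")
    case True
    then have "z = y0" by (simp add: z_def)
    then have "(y - z) * (y * z - y0\<^sup>2) = y0 * (y - y0)\<^sup>2" by (simp add: power2_eq_square algebra_simps)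
    then show ?thesis using ne \<open>z = y0\<close> pos by (simp add: z_def)
  next
    case False
    then have "z = 1" by (simp add: z_def)
    moreover have "1 < y0\<^sup>2" using False by simp
    moreover have "y < 1" using ne y(2) \<open>z = 1\<close> by (auto simp: z_def)
    ultimately show ?thesis by (intro mult_neg_neg) auto
  qed
  then have "0 < P * d * ((y - z) * (y * z - y0\<^sup>2) / (y * z))" using pos y z by simp
  with diff show ?thesis unfolding z_def by linarith
qed

lemma sqrt_mult_le_mean:
  fixes s t :: real
  assumes "0 < s" "0 < t"
  shows "sqrt s * sqrt t \<le> (s + t) / 2" and "s \<noteq> t \<Longrightarrow> sqrt s * sqrt t < (s + t) / 2"
proof -
  have e: "(s + t) / 2 - sqrt s * sqrt t = (sqrt s - sqrt t)\<^sup>2 / 2"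
    using assms by (simp add: power2_diff)
  then show "sqrt s * sqrt t \<le> (s + t) / 2" by (smt (verit) zero_le_power2 divide_nonneg_pos)
  show "sqrt s * sqrt t < (s + t) / 2" if "s \<noteq> t"
  proof -
    have "0 < (sqrt s - sqrt t)\<^sup>2" using that by simp
    with e show ?thesis by linarith
  qed
qed

text \<open>In logarithmic coordinates \<open>(sqrt x, sqrt y)\<close> is the midpoint of
  \<open>(x, 1)\<close> and \<open>(1, y)\<close>. AM-GM applies to each monomial, strictly to
  \<open>x\<close> or to \<open>y\<close> because the endpoints differ.\<close>

lemma cost_prod_corner_midpoint:
  assumes pos: "0 < r" "0 < a" "0 < b" "0 < m" "0 < c" "0 < d" "0 < x" "0 < y"
    and ne: "(x, 1) \<noteq> (1, y)"
  shows "cost_prod r a b m c d (sqrt x) (sqrt y) < (cost_prod r a b m c d x 1 + cost_prod r a b m c d 1 y) / 2"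
proof -
  have s: "0 < sqrt x" "0 < sqrt y" using pos by auto
  have t: "sqrt x \<le> (x+1)/2" "1 / sqrt x \<le> (1/x + 1)/2" "sqrt y \<le> (y+1)/2" "1 / sqrt y \<le> (1/y + 1)/2"
    "sqrt x / sqrt y \<le> (x + 1/y) / 2" "sqrt y / sqrt x \<le> (y + 1/x) / 2"
    using sqrt_mult_le_mean(1)[of x 1] sqrt_mult_le_mean(1)[of "1/x" 1] sqrt_mult_le_mean(1)[of y 1]
      sqrt_mult_le_mean(1)[of "1/y" 1] sqrt_mult_le_mean(1)[of x "1/y"] sqrt_mult_le_mean(1)[of y "1/x"] pos
    by (simp_all add: real_sqrt_divide)
  have "sqrt x < (x+1)/2 \<or> sqrt y < (y+1)/2"
    using ne sqrt_mult_le_mean(2)[of x 1] sqrt_mult_le_mean(2)[of y 1] pos by auto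
  moreover have le: "r*c * sqrt x \<le> r*c * ((x+1)/2)" "a*m * (1 / sqrt x) \<le> a*m * ((1/x + 1)/2)"
    "r*d * sqrt y \<le> r*d * ((y+1)/2)" "b*m * (1 / sqrt y) \<le> b*m * ((1/y + 1)/2)"
    "b*c * (sqrt x / sqrt y) \<le> b*c * ((x + 1/y) / 2)" "a*d * (sqrt y / sqrt x) \<le> a*d * ((y + 1/x) / 2)"
    by (rule mult_left_mono, fact, use pos in simp)+
  moreover have "r*c * sqrt x < r*c * ((x+1)/2)" if "sqrt x < (x+1)/2"
    using that pos by (intro mult_strict_left_mono) auto
  moreover have "r*d * sqrt y < r*d * ((y+1)/2)" if "sqrt y < (y+1)/2"
    using that pos by (intro mult_strict_left_mono) auto
  ultimately have "r*c * sqrt x + a*m * (1 / sqrt x) + r*d * sqrt y + b*m * (1 / sqrt y) + b*c * (sqrt x / sqrt y) + a*d * (sqrt y / sqrt x)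
     < r*c * ((x+1)/2) + a*m * ((1/x + 1)/2) + r*d * ((y+1)/2) + b*m * ((1/y + 1)/2) + b*c * ((x + 1/y) / 2) + a*d * ((y + 1/x) / 2)"
    by linarith
  then show ?thesis
    unfolding cost_prod_expand[OF s] cost_prod_expand[OF pos(7) zero_less_one] cost_prod_expand[OF zero_less_one pos(8)]
    by (simp add: algebra_simps add_divide_distrib)
qed

text \<open>In logarithmic coordinates the product is a positive combination of exponentials of linear forms.\<close>

lemma cost_prod_log_convex:
  assumes pos: "0 < r" "0 < a" "0 < b" "0 < m" "0 < c" "0 < d" and t: "0 \<le> t" "t \<le> 1"
  shows "cost_prod r a b m c d (exp ((1-t) * u + t * U)) (exp ((1-t) * v + t * V))
    \<le> (1-t) * cost_prod r a b m c d (exp u) (exp v) + t * cost_prod r a b m c d (exp U) (exp V)"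
proof -
  have e: "cost_prod r a b m c d (exp u) (exp v) = (r*m + a*c + b*d) + r*c * exp u + a*m * exp (-u) + r*d * exp v + b*m * exp (-v)
      + b*c * exp (u - v) + a*d * exp (v - u)" for u v
    by (simp add: cost_prod_expand exp_minus exp_diff inverse_eq_divide)
  have cv: "k * exp ((1-t) * p + t * q) \<le> (1-t) * (k * exp p) + t * (k * exp q)" if "0 \<le> k" for k p q :: real
  proof -
    have "exp ((1-t) * p + t * q) \<le> (1-t) * exp p + t * exp q"
      using convex_onD[OF exp_convex t, of p q] by simp
    from mult_left_mono[OF this that] show ?thesis by (simp add: algebra_simps)
  qed
  have n: "- ((1-t) * p + t * q) = (1-t) * (-p) + t * (-q)"
    "(1-t) * p + t * q - ((1-t) * p' + t * q') = (1-t) * (p - p') + t * (q - q')" for p q p' q' :: real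
    by (simp_all add: algebra_simps)
  show ?thesis unfolding e n
    using cv[of "r*c" u U] cv[of "a*m" "-u" "-U"] cv[of "r*d" v V] cv[of "b*m" "-v" "-V"]
      cv[of "b*c" "u-v" "U-V"] cv[of "a*d" "v-u" "V-U"] pos
    by (simp add: algebra_simps)
qed

lemma cost_prod_move_to_edge:
  assumes pos: "0 < r" "0 < a" "0 < b" "0 < m" "0 < c" "0 < d" "0 < X" "0 < Y"
    and X: "r * c * X\<^sup>2 = a * m" and Y: "r * d * Y\<^sup>2 = b * m"
    and out: "1 < max X Y" and box: "x \<in> {0<..1}" "y \<in> {0<..1}"
  obtains "x = 1 \<or> y = 1"
  | x' y' where "x' \<in> {0<..1}" "y' \<in> {0<..1}" "x' = 1 \<or> y' = 1"
      "cost_prod r a b m c d x' y' < cost_prod r a b m c d x y"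
proof (cases "x = 1 \<or> y = 1")
  case False
  define u v U V where "u = ln x" "v = ln y" "U = ln X" "V = ln Y"
  have ex: "x = exp u" "y = exp v" "X = exp U" "Y = exp V"
    using box pos by (auto simp: u_v_U_V_def)
  have neg: "u < 0" "v < 0" using False box by (auto simp: u_v_U_V_def)
  \<comment> \<open>This is the larger logarithmic coordinate along the segment from
    \<open>(x, y)\<close> to \<open>(X, Y)\<close>. At a zero of \<open>h\<close> both coordinates
    are at most 1 and one of them equals 1, so the point lies on an edge.\<close>
  define h where "h t = max ((1-t) * u + t * U) ((1-t) * v + t * V)" for t :: real
  have "\<exists>t\<ge>0. t \<le> 1 \<and> h t = 0"
  proof (rule IVT')
    show "h 0 \<le> 0" using neg by (simp add: h_def)
    show "0 \<le> h 1" using out unfolding h_def ex by (auto simp: max_def split: if_splits)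
    show "continuous_on {0..1} h" unfolding h_def by (intro continuous_intros)
  qed simp
  then obtain t where t: "0 \<le> t" "t \<le> 1" "h t = 0" by blast
  \<comment> \<open>Only a positive share of the strict minimum at \<open>(X, Y)\<close> makes the
    convexity bound a strict decrease.\<close>
  have "t \<noteq> 0" using t neg by (auto simp: h_def)
  define x' y' where "x' = exp ((1-t) * u + t * U)" "y' = exp ((1-t) * v + t * V)"
  have "cost_prod r a b m c d x' y' \<le> (1-t) * cost_prod r a b m c d x y + t * cost_prod r a b m c d X Y"
    unfolding x'_y'_def ex by (rule cost_prod_log_convex[OF pos(1-6) t(1,2)])
  also have "t * cost_prod r a b m c d X Y < t * cost_prod r a b m c d x y"
    using \<open>t \<noteq> 0\<close> t pos box out
    by (intro mult_strict_left_mono cost_prod_gt_star X Y) auto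
  finally have "cost_prod r a b m c d x' y' < cost_prod r a b m c d x y" by (simp add: algebra_simps)
  moreover have "x' \<in> {0<..1}" "y' \<in> {0<..1}" "x' = 1 \<or> y' = 1"
    using t(3) by (auto simp: x'_y'_def h_def max_def split: if_splits)
  ultimately show ?thesis using that(2) by blast
qed (use that in blast)

text \<open>\<open>x0\<close> and \<open>y0\<close> solve the stationarity equations on the lines
  \<open>y = 1\<close> and \<open>x = 1\<close>. Interior points lose to an edge point, and edge
  points lose to the minimum of their edge, so only the two candidates compared in \<open>p\<close>
  remain.\<close>

lemma cost_prod_constrained_min:
  assumes pos: "0 < r" "0 < a" "0 < b" "0 < m" "0 < c" "0 < d" "0 < X" "0 < Y"
    and X: "r * c * X\<^sup>2 = a * m" and Y: "r * d * Y\<^sup>2 = b * m"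
    and out: "1 < max X Y"
    and x0: "0 < x0" "(r + b) * c * x0\<^sup>2 = a * (m + d)" 
    and y0: "0 < y0" "(r + a) * d * y0\<^sup>2 = b * (m + c)"
    and box: "x \<in> {0<..1}" "y \<in> {0<..1}"
    and best: "p = (if cost_prod r a b m c d 1 (min 1 y0) \<le> cost_prod r a b m c d (min 1 x0) 1
                    then (1, min 1 y0) else (min 1 x0, 1))"
    and ne: "(x, y) \<noteq> p"
  shows "case_prod (cost_prod r a b m c d) p < cost_prod r a b m c d x y"
proof -
  let ?f = "cost_prod r a b m c d"
  define xb yb where "xb = min 1 x0" "yb = min 1 y0"
  have bpos: "0 < xb" "0 < yb" "xb \<le> 1" "yb \<le> 1" using x0 y0 by (auto simp: xb_yb_def)
  have val: "case_prod ?f p = min (?f 1 yb) (?f xb 1)"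
    using best by (auto simp: xb_yb_def)
  have right: "?f 1 yb < ?f 1 y" if "y \<in> {0<..1}" "y \<noteq> yb" for y
    using edge_min[of "r + a" "m + c" b d y0 y] pos y0 that by (simp add: cost_prod_def xb_yb_def)
  have top: "?f xb 1 < ?f x 1" if "x \<in> {0<..1}" "x \<noteq> xb" for x
    using edge_min[of "r + b" "m + d" a c x0 x] pos x0 that
    by (simp add: cost_prod_def xb_yb_def add_ac)
  have edge: "case_prod ?f p \<le> ?f x y" "(x, y) \<notin> {(1, yb), (xb, 1)} \<Longrightarrow> case_prod ?f p < ?f x y"
    if "x \<in> {0<..1}" "y \<in> {0<..1}" "x = 1 \<or> y = 1" for x y
    using that right[of y] top[of x] unfolding val by (fastforce simp: min_def)+
  have all: "case_prod ?f p \<le> ?f x y" "(x, y) \<notin> {(1, yb), (xb, 1)} \<Longrightarrow> case_prod ?f p < ?f x y"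
    if xy: "x \<in> {0<..1}" "y \<in> {0<..1}" for x y
  proof -
    consider "x = 1 \<or> y = 1" | x' y' where "x' \<in> {0<..1}" "y' \<in> {0<..1}" "x' = 1 \<or> y' = 1" "?f x' y' < ?f x y"
      using cost_prod_move_to_edge[OF pos X Y out xy] by metis
    then have "case_prod ?f p \<le> ?f x y \<and> ((x, y) \<notin> {(1, yb), (xb, 1)} \<longrightarrow> case_prod ?f p < ?f x y)"
    proof cases
      case 1 then show ?thesis using edge xy by blast
    next
      case 2 then show ?thesis using edge(1)[OF 2(1-3)] by linarith
    qed
    then show "case_prod ?f p \<le> ?f x y" "(x, y) \<notin> {(1, yb), (xb, 1)} \<Longrightarrow> case_prod ?f p < ?f x y" by auto
  qed
  show ?thesis
  proof (cases "(x, y) \<in> {(1, yb), (xb, 1)}")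
    case False then show ?thesis using all(2)[OF box] by simp
  next
    case True
    show ?thesis
    proof (cases "?f 1 yb = ?f xb 1")
      case False
      then show ?thesis using True ne best unfolding val by (auto simp: xb_yb_def min_def split: if_splits)
    next
      case tie: True
      \<comment> \<open>Two distinct minimisers are impossible: the geometric mean of the two corners would do better.\<close>
      then have p: "p = (1, yb)" using best by (simp add: xb_yb_def)
      with True ne have "(xb, 1) \<noteq> (1, yb)" by auto
      from cost_prod_corner_midpoint[OF pos(1-6) bpos(1,2) this] tie p
      have "?f (sqrt xb) (sqrt yb) < case_prod ?f p" by simp
      moreover have "case_prod ?f p \<le> ?f (sqrt xb) (sqrt yb)" using bpos by (intro all(1)) auto
      ultimately show ?thesis by simp
    qed
  qed
qed

section \<open>The limiting efficiency\<close>

lemma integral_uniform_measure_times_measure: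
  fixes f :: "'a \<Rightarrow> real"
  assumes f [measurable]: "f \<in> borel_measurable M" and A [measurable]: "A \<in> sets M"
    and pos: "0 < measure M A"
  shows "(\<integral>x. f x \<partial>uniform_measure M A) * measure M A = (\<integral>x. indicator A x * f x \<partial>M)"
proof -
  \<comment> \<open>\<open>measure\<close> is 0 by convention where \<open>emeasure\<close> is
    infinite, so positivity also yields finiteness.\<close>
  have "emeasure M A \<noteq> \<infinity>" using pos by (auto simp: measure_def)
  then have em: "emeasure M A = ennreal (measure M A)" by (simp add: emeasure_eq_ennreal_measure)
  have "uniform_measure M A = density M (\<lambda>x. ennreal (indicator A x / measure M A))"
    unfolding uniform_measure_def em using pos
    by (intro arg_cong[where f = "density M"] ext) (auto simp: divide_ennreal simp flip: ennreal_1 split: split_indicator)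
  then have "(\<integral>x. f x \<partial>uniform_measure M A) = (\<integral>x. (1 / measure M A) * (indicator A x * f x) \<partial>M)"
    by (simp add: integral_density)
  also have "\<dots> = (1 / measure M A) * (\<integral>x. indicator A x * f x \<partial>M)"
    by (rule integral_mult_right_zero)
  finally show ?thesis using pos by simp
qed

text \<open>The tuple that generates the first family in the independence clause of
  \<open>mf_setting\<close>.\<close>

definition outcome :: "('w, 'p, 'a, 'b) mf_model \<Rightarrow> 'w \<Rightarrow> 'p \<times> 'a \<times> 'b \<times> real \<times> real" where
  "outcome S \<omega> = (param S \<omega>, lo_out S \<omega>, hi_out S \<omega>, lo_cost S \<omega>, hi_cost S \<omega>)"

abbreviation outcome_space :: "('w, 'p, 'a, 'b) mf_model \<Rightarrow> ('p \<times> 'a \<times> 'b \<times> real \<times> real) measure" where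
  "outcome_space S \<equiv> prior S \<Otimes>\<^sub>M lo_space S \<Otimes>\<^sub>M hi_space S \<Otimes>\<^sub>M borel \<Otimes>\<^sub>M borel"

section \<open>Moments of a single draw\<close>

locale multifidelity =
  fixes S :: "('w, 'p, 'a, 'b) mf_model"
  assumes setting: "mf_setting S"
begin

sublocale prob_space "law S"
  using setting by (simp add: mf_setting_def)

lemma measurable_model [measurable]:
  "param S \<in> law S \<rightarrow>\<^sub>M prior S" "lo_out S \<in> law S \<rightarrow>\<^sub>M lo_space S" "lo_nbhd S \<in> sets (lo_space S)"
  "hi_out S \<in> law S \<rightarrow>\<^sub>M hi_space S" "hi_nbhd S \<in> sets (hi_space S)" "unif S \<in> borel_measurable (law S)"
  "lo_cost S \<in> borel_measurable (law S)" "hi_cost S \<in> borel_measurable (law S)"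
  using setting by (auto simp: mf_setting_def)

lemma measurable_outcome [measurable]: "outcome S \<in> law S \<rightarrow>\<^sub>M outcome_space S"
  unfolding outcome_def by measurable

lemma lo_pos_sets [measurable]: "lo_pos S \<in> sets (law S)"
  and lo_neg_sets [measurable]: "lo_neg S \<in> sets (law S)"
  and hi_pos_sets [measurable]: "hi_pos S \<in> sets (law S)"
  and hi_neg_sets [measurable]: "hi_neg S \<in> sets (law S)"
  unfolding lo_pos_def lo_neg_def hi_pos_def hi_neg_def by measurable

lemma unif_less_integral:
  assumes "\<eta> \<in> {0<..1}"
  shows "(\<integral>\<omega>. of_bool (unif S \<omega> < \<eta>) \<partial>law S) = \<eta>"
proof -
  have "(\<integral>\<omega>. of_bool (unif S \<omega> < \<eta>) \<partial>law S) = (\<integral>u. (of_bool (u < \<eta>) :: real) \<partial>distr (law S) borel (unif S))"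
    by (subst integral_distr) auto
  also have "distr (law S) borel (unif S) = uniform_measure lborel {0<..<1}"
    using setting by (simp add: mf_setting_def)
  also have "(\<integral>u. (of_bool (u < \<eta>) :: real) \<partial>uniform_measure lborel {0<..<1::real}) =
      (\<integral>u. indicator {0<..<1} u * of_bool (u < \<eta>) \<partial>lborel)"
    using integral_uniform_measure_times_measure[of "\<lambda>u. of_bool (u < \<eta>)" lborel "{0<..<1::real}"] by simp
  also have "\<dots> = (\<integral>u. indicator {0<..<\<eta>} u \<partial>lborel)"
    using assms by (intro Bochner_Integration.integral_cong) (auto simp: indicator_def)
  also have "\<dots> = \<eta>" using assms by simp
  finally show ?thesis .
qed

text \<open>Events of the composed variables are already events of \<open>outcome\<close> and
  \<open>unif\<close>, so they inherit the product rule. Real values give both variables the common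
  type that \<open>indep_var\<close> needs.\<close>

lemma indep_outcome_unif:
  fixes f :: "'p \<times> 'a \<times> 'b \<times> real \<times> real \<Rightarrow> real" and g :: "real \<Rightarrow> real"
  assumes [measurable]: "f \<in> borel_measurable (outcome_space S)" "g \<in> borel_measurable borel"
  shows "indep_var borel (\<lambda>\<omega>. g (unif S \<omega>)) borel (\<lambda>\<omega>. f (outcome S \<omega>))"
proof -
  let ?F = "{outcome S -` A \<inter> space (law S) | A. A \<in> sets (outcome_space S)}"
  let ?G = "{unif S -` B \<inter> space (law S) | B. B \<in> sets borel}"
  have "indep_set ?F ?G"
    using setting by (simp add: mf_setting_def outcome_def[abs_def])
  then have indep: "prob (a \<inter> b) = prob a * prob b" if "a \<in> ?F" "b \<in> ?G" for a b
    using that by (rule indep_setD)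
  have F: "(\<lambda>\<omega>. f (outcome S \<omega>)) -` A \<inter> space (law S) \<in> ?F" if "A \<in> sets borel" for A
  proof -
    have "(\<lambda>\<omega>. f (outcome S \<omega>)) -` A \<inter> space (law S)
        = outcome S -` (f -` A \<inter> space (outcome_space S)) \<inter> space (law S)"
      using measurable_space[OF measurable_outcome] by auto
    moreover have "f -` A \<inter> space (outcome_space S) \<in> sets (outcome_space S)"
      using that by (rule measurable_sets[OF assms(1)])
    ultimately show ?thesis by blast
  qed
  have G: "(\<lambda>\<omega>. g (unif S \<omega>)) -` B \<inter> space (law S) \<in> ?G" if "B \<in> sets borel" for B
  proof -
    have "g -` B \<in> sets borel" using measurable_sets[OF assms(2) that] by simp
    then show ?thesis by (auto intro!: exI[of _ "g -` B"])
  qed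
  have "indep_set {(\<lambda>\<omega>. g (unif S \<omega>)) -` B \<inter> space (law S) | B. B \<in> sets borel}
      {(\<lambda>\<omega>. f (outcome S \<omega>)) -` A \<inter> space (law S) | A. A \<in> sets borel}"
    unfolding indep_sets2_eq
  proof (intro conjI ballI)
    fix b a
    assume "b \<in> {(\<lambda>\<omega>. g (unif S \<omega>)) -` B \<inter> space (law S) | B. B \<in> sets borel}"
      and "a \<in> {(\<lambda>\<omega>. f (outcome S \<omega>)) -` A \<inter> space (law S) | A. A \<in> sets borel}"
    with F G have "a \<in> ?F" "b \<in> ?G" by blast+
    from indep[OF this] show "prob (b \<inter> a) = prob b * prob a" by (simp add: ac_simps)
  qed auto
  \<comment> \<open>This matches the family indexed by bool in \<open>indep_vars_def2\<close> with
    the \<open>case_bool\<close> form of \<open>indep_set_def\<close>.\<close>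
  moreover have "(\<lambda>i. {case_bool (\<lambda>\<omega>. g (unif S \<omega>)) (\<lambda>\<omega>. f (outcome S \<omega>)) i -` A \<inter> space (law S) | A.
        A \<in> sets (case_bool borel borel i)})
      = case_bool {(\<lambda>\<omega>. g (unif S \<omega>)) -` B \<inter> space (law S) | B. B \<in> sets borel}
          {(\<lambda>\<omega>. f (outcome S \<omega>)) -` A \<inter> space (law S) | A. A \<in> sets borel}"
    by (rule ext) (simp split: bool.split)
  ultimately show ?thesis
    unfolding indep_var_def indep_vars_def2 indep_set_def by (simp split: bool.split)
qed

text \<open>Independence factors the expectation. The threshold is constant here, so the random
  \<open>cont_prob\<close> is handled by first splitting on whether \<open>lo_out\<close> lies in
  its neighbourhood.\<close>

lemma has_integral_thinned:
  fixes f :: "'p \<times> 'a \<times> 'b \<times> real \<times> real \<Rightarrow> real"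
  assumes [measurable]: "f \<in> borel_measurable (outcome_space S)"
    and f: "has_bochner_integral (law S) (\<lambda>\<omega>. f (outcome S \<omega>)) e" and \<eta>: "\<eta> \<in> {0<..1}"
  shows "has_bochner_integral (law S) (\<lambda>\<omega>. of_bool (unif S \<omega> < \<eta>) * f (outcome S \<omega>)) (\<eta> * e)"
proof -
  have ind: "indep_var borel (\<lambda>\<omega>. of_bool (unif S \<omega> < \<eta>)) borel (\<lambda>\<omega>. f (outcome S \<omega>))"
    by (rule indep_outcome_unif) auto
  have int: "integrable (law S) (\<lambda>\<omega>. of_bool (unif S \<omega> < \<eta>) :: real)"
    by (rule integrable_const_bound[where B = 1]) auto
  have int_f: "integrable (law S) (\<lambda>\<omega>. f (outcome S \<omega>))" "(\<integral>\<omega>. f (outcome S \<omega>) \<partial>law S) = e"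
    using f by (auto simp: has_bochner_integral_iff)
  show ?thesis
    unfolding has_bochner_integral_iff
    using indep_var_integrable[OF ind int int_f(1)] indep_var_lebesgue_integral[OF ind int int_f(1)]
      unif_less_integral[OF \<eta>] int_f(2) by simp
qed

lemma has_integral_event:
  assumes "A \<in> sets (law S)" "\<And>\<omega>. \<omega> \<in> space (law S) \<Longrightarrow> f (outcome S \<omega>) = indicator A \<omega>"
  shows "has_bochner_integral (law S) (\<lambda>\<omega>. f (outcome S \<omega>)) (measure (law S) A)"
  by (subst has_bochner_integral_cong[OF refl assms(2) refl], assumption)
    (use assms(1) in \<open>simp add: has_bochner_integral_real_indicator emeasure_eq_measure\<close>)

lemma mf_weight_moments:
  assumes \<eta>: "\<eta>1 \<in> {0<..1}" "\<eta>2 \<in> {0<..1}"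
  shows "has_bochner_integral (law S) (mf_weight S \<eta>1 \<eta>2) (p_tp S + p_fn S)"
    and "has_bochner_integral (law S) (\<lambda>\<omega>. (mf_weight S \<eta>1 \<eta>2 \<omega>)\<^sup>2)
      ((p_tp S - p_fp S) + 1 / \<eta>1 * p_fp S + 1 / \<eta>2 * p_fn S)"
proof -
  define tp fp fn :: "'p \<times> 'a \<times> 'b \<times> real \<times> real \<Rightarrow> real"
    where "tp = (\<lambda>(_, a, b, _, _). of_bool (a \<in> lo_nbhd S \<and> b \<in> hi_nbhd S))"
    and "fp = (\<lambda>(_, a, b, _, _). of_bool (a \<in> lo_nbhd S \<and> b \<notin> hi_nbhd S))"
    and "fn = (\<lambda>(_, a, b, _, _). of_bool (a \<notin> lo_nbhd S \<and> b \<in> hi_nbhd S))"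
  note defs = tp_def fp_def fn_def
  have meas [measurable]: "tp \<in> borel_measurable (outcome_space S)" "fp \<in> borel_measurable (outcome_space S)"
    "fn \<in> borel_measurable (outcome_space S)"
    unfolding defs by measurable
  have tp: "has_bochner_integral (law S) (\<lambda>\<omega>. tp (outcome S \<omega>)) (p_tp S)"
    and fp: "has_bochner_integral (law S) (\<lambda>\<omega>. fp (outcome S \<omega>)) (p_fp S)"
    and fn: "has_bochner_integral (law S) (\<lambda>\<omega>. fn (outcome S \<omega>)) (p_fn S)"
    unfolding p_tp_def p_fp_def p_fn_def
    by (rule has_integral_event; auto simp: defs outcome_def lo_pos_def lo_neg_def hi_pos_def hi_neg_def)+
  have fp1: "has_bochner_integral (law S) (\<lambda>\<omega>. of_bool (unif S \<omega> < \<eta>1) * fp (outcome S \<omega>)) (\<eta>1 * p_fp S)"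
    and fn2: "has_bochner_integral (law S) (\<lambda>\<omega>. of_bool (unif S \<omega> < \<eta>2) * fn (outcome S \<omega>)) (\<eta>2 * p_fn S)"
    using fp fn \<eta> by (auto intro!: has_integral_thinned)
  note add = has_bochner_integral_add
  note scale = has_bochner_integral_mult_right
  \<comment> \<open>With \<open>I\<close> the indicator of continuation, the weight is 1 on true
    positives, \<open>1 - I / \<eta>1\<close> on false positives, \<open>I / \<eta>2\<close> on
    false negatives and 0 otherwise.\<close>
  have w: "mf_weight S \<eta>1 \<eta>2 \<omega> = tp (outcome S \<omega>) + fp (outcome S \<omega>)
      + (- 1 / \<eta>1 * (of_bool (unif S \<omega> < \<eta>1) * fp (outcome S \<omega>))
      + 1 / \<eta>2 * (of_bool (unif S \<omega> < \<eta>2) * fn (outcome S \<omega>)))" for \<omega>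
    by (auto simp: mf_weight_def lo_weight_def hi_weight_def cont_prob_def outcome_def defs indicator_def)
  have "has_bochner_integral (law S) (mf_weight S \<eta>1 \<eta>2)
      (p_tp S + p_fp S + (- 1 / \<eta>1 * (\<eta>1 * p_fp S) + 1 / \<eta>2 * (\<eta>2 * p_fn S)))"
    unfolding w[abs_def] by (intro add scale tp fp fp1 fn2)
  then show "has_bochner_integral (law S) (mf_weight S \<eta>1 \<eta>2) (p_tp S + p_fn S)"
    using \<eta> by simp
  \<comment> \<open>Since \<open>I\<close> is idempotent, the square on false positives is
    \<open>1 + (1 / \<eta>1\<^sup>2 - 2 / \<eta>1) * I\<close>, which integrates to
    \<open>(1 / \<eta>1 - 1) * p_fp S\<close>.\<close>
  have w2: "(mf_weight S \<eta>1 \<eta>2 \<omega>)\<^sup>2 = tp (outcome S \<omega>) + fp (outcome S \<omega>)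
      + ((1 / \<eta>1\<^sup>2 - 2 / \<eta>1) * (of_bool (unif S \<omega> < \<eta>1) * fp (outcome S \<omega>))
      + 1 / \<eta>2\<^sup>2 * (of_bool (unif S \<omega> < \<eta>2) * fn (outcome S \<omega>)))" for \<omega>
    by (auto simp: mf_weight_def lo_weight_def hi_weight_def cont_prob_def outcome_def defs indicator_def
      power2_diff power_divide)
  have "has_bochner_integral (law S) (\<lambda>\<omega>. (mf_weight S \<eta>1 \<eta>2 \<omega>)\<^sup>2)
      (p_tp S + p_fp S + ((1 / \<eta>1\<^sup>2 - 2 / \<eta>1) * (\<eta>1 * p_fp S) + 1 / \<eta>2\<^sup>2 * (\<eta>2 * p_fn S)))"
    unfolding w2 by (intro add scale tp fp fp1 fn2)
  also have "p_tp S + p_fp S + ((1 / \<eta>1\<^sup>2 - 2 / \<eta>1) * (\<eta>1 * p_fp S) + 1 / \<eta>2\<^sup>2 * (\<eta>2 * p_fn S))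
      = (p_tp S - p_fp S) + 1 / \<eta>1 * p_fp S + 1 / \<eta>2 * p_fn S"
    using \<eta> by (simp add: field_simps power2_eq_square)
  finally show "has_bochner_integral (law S) (\<lambda>\<omega>. (mf_weight S \<eta>1 \<eta>2 \<omega>)\<^sup>2)
      ((p_tp S - p_fp S) + 1 / \<eta>1 * p_fp S + 1 / \<eta>2 * p_fn S)" .
qed

lemma mf_time_mean:
  assumes \<eta>: "\<eta>1 \<in> {0<..1}" "\<eta>2 \<in> {0<..1}" and pos: "0 < p_fp S" "0 < p_fn S"
  shows "has_bochner_integral (law S) (mf_time S \<eta>1 \<eta>2) (mean_lo_cost S + \<eta>1 * c_p S + \<eta>2 * c_n S)"
proof -
  define cp cn :: "'p \<times> 'a \<times> 'b \<times> real \<times> real \<Rightarrow> real"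
    where "cp = (\<lambda>(_, a, _, _, c). of_bool (a \<in> lo_nbhd S) * c)"
    and "cn = (\<lambda>(_, a, _, _, c). of_bool (a \<notin> lo_nbhd S) * c)"
  note defs = cp_def cn_def
  have meas [measurable]: "cp \<in> borel_measurable (outcome_space S)" "cn \<in> borel_measurable (outcome_space S)"
    unfolding defs by measurable
  have int: "integrable (law S) (lo_cost S)" "integrable (law S) (hi_cost S)"
    using setting by (auto simp: mf_setting_def)
  have part: "has_bochner_integral (law S) (\<lambda>\<omega>. f (outcome S \<omega>))
      ((\<integral>\<omega>. hi_cost S \<omega> \<partial>uniform_measure (law S) A) * measure (law S) A)"
    if A: "A \<in> sets (law S)" "0 < measure (law S) A"
      and f: "\<And>\<omega>. \<omega> \<in> space (law S) \<Longrightarrow> f (outcome S \<omega>) = indicator A \<omega> * hi_cost S \<omega>" for A f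
  proof -
    have "integrable (law S) (\<lambda>\<omega>. indicator A \<omega> * hi_cost S \<omega>)"
      using integrable_mult_indicator[OF A(1) int(2)] by simp
    then show ?thesis
      unfolding integral_uniform_measure_times_measure[OF borel_measurable_integrable[OF int(2)] A]
      by (subst has_bochner_integral_cong[OF refl f refl]) (auto simp: has_bochner_integral_iff)
  qed
  \<comment> \<open>Both conditioning events get positive probability, which turns the conditional
    expectations in \<open>c_p\<close> and \<open>c_n\<close> into restricted integrals.\<close>
  have "p_fp S \<le> measure (law S) (lo_pos S)" "p_fn S \<le> measure (law S) (lo_neg S)"
    unfolding p_fp_def p_fn_def by (intro finite_measure_mono; auto)+
  then have "0 < measure (law S) (lo_pos S)" "0 < measure (law S) (lo_neg S)" using pos by linarith+
  then have cp: "has_bochner_integral (law S) (\<lambda>\<omega>. cp (outcome S \<omega>)) (c_p S)"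
    and cn: "has_bochner_integral (law S) (\<lambda>\<omega>. cn (outcome S \<omega>)) (c_n S)"
    unfolding c_p_def c_n_def
    by (intro part; auto simp: defs outcome_def lo_pos_def lo_neg_def)+
  have T: "mf_time S \<eta>1 \<eta>2 \<omega> = lo_cost S \<omega> + of_bool (unif S \<omega> < \<eta>1) * cp (outcome S \<omega>)
      + of_bool (unif S \<omega> < \<eta>2) * cn (outcome S \<omega>)" for \<omega>
    by (auto simp: mf_time_def cont_prob_def outcome_def defs indicator_def)
  show ?thesis
    unfolding T[abs_def] mean_lo_cost_def
    using \<eta> by (intro has_bochner_integral_add has_integral_thinned cp cn meas has_bochner_integral_integrable int)
qed

text \<open>Rescaling the squared sum by \<open>N\<^sup>2\<close> and both denominators by
  \<open>N\<close> leaves the ratio unchanged for \<open>N > 0\<close>, so the strong law for the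
  weight, its square and the time gives the limit. As \<open>phi\<close> is nonzero, so are both
  limiting denominators.\<close>

lemma limiting_efficiency:
  assumes \<eta>: "\<eta>1 \<in> {0<..1}" "\<eta>2 \<in> {0<..1}" and pos: "0 < p_fp S" "0 < p_fn S" and phi: "phi S \<eta>1 \<eta>2 \<noteq> 0"
  shows "has_limiting_efficiency S \<eta>1 \<eta>2 ((p_tp S + p_fn S)\<^sup>2 / phi S \<eta>1 \<eta>2)"
proof -
  interpret seq: sequence_space "law S" by unfold_locales
  let ?w = "mf_weight S \<eta>1 \<eta>2" and ?T = "mf_time S \<eta>1 \<eta>2"
  define W where "W = (p_tp S - p_fp S) + 1 / \<eta>1 * p_fp S + 1 / \<eta>2 * p_fn S"
  define T where "T = mean_lo_cost S + \<eta>1 * c_p S + \<eta>2 * c_n S"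
  have phi_eq: "phi S \<eta>1 \<eta>2 = W * T" by (simp add: phi_def W_def T_def)
  have lln: "AE x in sample_space S. (\<lambda>N. (\<Sum>i<N. f (x i)) / real N) \<longlonglongrightarrow> e"
    if "has_bochner_integral (law S) f e" for f and e :: real
    using that seq.strong_law_of_large_numbers[of f] unfolding sample_space_def has_bochner_integral_iff by simp
  have "AE x in sample_space S. (\<lambda>N. (\<Sum>i<N. ?w (x i)) / real N) \<longlonglongrightarrow> p_tp S + p_fn S"
    "AE x in sample_space S. (\<lambda>N. (\<Sum>i<N. (?w (x i))\<^sup>2) / real N) \<longlonglongrightarrow> W"
    "AE x in sample_space S. (\<lambda>N. (\<Sum>i<N. ?T (x i)) / real N) \<longlonglongrightarrow> T"
    unfolding W_def T_def by (intro lln mf_weight_moments mf_time_mean \<eta> pos)+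
  then show ?thesis unfolding has_limiting_efficiency_def
  proof eventually_elim
    case (elim x)
    have "(\<lambda>N. ((\<Sum>i<N. ?w (x i)) / real N)\<^sup>2 / ((\<Sum>i<N. (?w (x i))\<^sup>2) / real N) / ((\<Sum>i<N. ?T (x i)) / real N))
        \<longlonglongrightarrow> (p_tp S + p_fn S)\<^sup>2 / W / T"
      using phi by (intro tendsto_intros elim) (auto simp: phi_eq)
    moreover have "\<forall>\<^sub>F N in sequentially.
        ((\<Sum>i<N. ?w (x i)) / real N)\<^sup>2 / ((\<Sum>i<N. (?w (x i))\<^sup>2) / real N) / ((\<Sum>i<N. ?T (x i)) / real N)
        = ESS S \<eta>1 \<eta>2 N x / total_time S \<eta>1 \<eta>2 N x"
      using eventually_gt_at_top[of 0]
      by eventually_elim (simp add: ESS_def total_time_def power_divide power2_eq_square)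
    ultimately show ?case by (simp add: tendsto_cong phi_eq)
  qed
qed

text \<open>Almost every sample has both limits, and a probability space is not null, so such a
  sample exists.\<close>

lemma limiting_efficiency_unique:
  assumes "has_limiting_efficiency S \<eta>1 \<eta>2 L" "has_limiting_efficiency S \<eta>1 \<eta>2 L'"
  shows "L = L'"
proof -
  interpret seq: sequence_space "law S" by unfold_locales
  have "AE x in sample_space S. L = L'"
    using assms unfolding has_limiting_efficiency_def
    by eventually_elim (rule LIMSEQ_unique)
  then show ?thesis unfolding sample_space_def by (rule seq.P.AE_const[THEN iffD1])
qed

text \<open>The limit exists and is unique at every admissible pair, so the efficiencies compare as
  a fixed numerator over \<open>phi\<close>. That numerator must be positive, since otherwise all
  pairs would tie.\<close>

lemma efficiency_maximisers_eq_singleton: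
  assumes pos: "0 < p_fp S" "0 < p_fn S" "0 < R_0 S"
    and phi: "\<And>x y. x \<in> {0<..1} \<Longrightarrow> y \<in> {0<..1} \<Longrightarrow> 0 < phi S x y"
    and best: "fst p \<in> {0<..1}" "snd p \<in> {0<..1}"
      "\<And>x y. x \<in> {0<..1} \<Longrightarrow> y \<in> {0<..1} \<Longrightarrow> (x, y) \<noteq> p \<Longrightarrow> case_prod (phi S) p < phi S x y"
  shows "efficiency_maximisers S = {p}"
proof -
  let ?e = "\<lambda>x y. (p_tp S + p_fn S)\<^sup>2 / phi S x y"
  have num: "0 < (p_tp S + p_fn S)\<^sup>2" using pos by (simp add: R_0_def)
  have eff: "has_limiting_efficiency S x y L \<longleftrightarrow> L = ?e x y" if "x \<in> {0<..1}" "y \<in> {0<..1}" for x y L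
    using limiting_efficiency[OF that pos(1,2)] limiting_efficiency_unique phi[OF that] by fastforce
  have le: "?e x y \<le> ?e x' y' \<longleftrightarrow> phi S x' y' \<le> phi S x y"
    if "x \<in> {0<..1}" "y \<in> {0<..1}" "x' \<in> {0<..1}" "y' \<in> {0<..1}" for x y x' y'
    using num phi[OF that(1,2)] phi[OF that(3,4)] by (simp add: divide_simps)
  have "efficiency_maximisers S =
      {(x, y). x \<in> {0<..1} \<and> y \<in> {0<..1} \<and> (\<forall>x'\<in>{0<..1}. \<forall>y'\<in>{0<..1}. phi S x y \<le> phi S x' y')}"
    unfolding efficiency_maximisers_def
    by (auto simp: eff le simp del: greaterThanAtMost_iff)
  also have "\<dots> = {p}"
  proof (rule set_eqI, clarify)
    fix x y
    show "(x, y) \<in> {(x, y). x \<in> {0<..1} \<and> y \<in> {0<..1} \<and> (\<forall>x'\<in>{0<..1}. \<forall>y'\<in>{0<..1}. phi S x y \<le> phi S x' y')}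
      \<longleftrightarrow> (x, y) \<in> {p}"
    proof (cases "(x, y) = p")
      case True
      then show ?thesis using best by (force simp del: greaterThanAtMost_iff intro: less_imp_le)
    next
      case False
      then have "\<not> phi S x y \<le> case_prod (phi S) p" if "x \<in> {0<..1}" "y \<in> {0<..1}"
        using best(3)[OF that] by simp
      with False best(1,2) show ?thesis by (auto simp: case_prod_beta simp del: greaterThanAtMost_iff)
    qed
  qed
  finally show ?thesis .
qed

end

section \<open>The optimal continuation probabilities\<close>

theorem corollary4p4:
  fixes S :: "('w, 'p, 'a, 'b) mf_model"
  assumes "mf_setting S"
    and "0 < mean_lo_cost S" and "0 < c_p S" and "0 < c_n S"
    and "0 < p_fp S" and "0 < p_fn S"
    and "0 < R_0 S"
  shows "(max (R_p S) (R_n S) \<le> R_0 S \<longrightarrow>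
            eta1_star S \<in> {0<..1} \<and> eta2_star S \<in> {0<..1} \<and>
            efficiency_maximisers S = {(eta1_star S, eta2_star S)}) \<and>
         (max (R_p S) (R_n S) > R_0 S \<longrightarrow>
            (eta1_star S > 1 \<or> eta2_star S > 1) \<and>
            efficiency_maximisers S =
              {if phi S 1 (eta2_bar S) \<le> phi S (eta1_bar S) 1
               then (1, eta2_bar S) else (eta1_bar S, 1)})"
proof -
  interpret multifidelity S using assms(1) by unfold_locales
  let ?r = "R_0 S" and ?a = "p_fp S" and ?b = "p_fn S" and ?m = "mean_lo_cost S" and ?c = "c_p S" and ?d = "c_n S"
  note pos = assms(2-)
  have phi: "phi S = cost_prod ?r ?a ?b ?m ?c ?d"
    by (intro ext) (simp add: phi_def cost_prod_def R_0_def mult.commute)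
  have phi_pos: "0 < phi S x y" if "x \<in> {0<..1}" "y \<in> {0<..1}" for x y
    unfolding phi cost_prod_def using that pos by (auto intro!: mult_pos_pos add_pos_pos)
  have R: "0 < R_p S" "0 < R_n S" using pos by (auto simp: R_p_def R_n_def)
  have star_pos: "0 < eta1_star S" "0 < eta2_star S"
    using R pos by (auto simp: eta1_star_def eta2_star_def)
  have star_le: "eta1_star S \<le> 1 \<longleftrightarrow> R_p S \<le> ?r" "eta2_star S \<le> 1 \<longleftrightarrow> R_n S \<le> ?r"
    using pos by (auto simp: eta1_star_def eta2_star_def)
  have star_sq: "(eta1_star S)\<^sup>2 = ?a * ?m / (?r * ?c)" "(eta2_star S)\<^sup>2 = ?b * ?m / (?r * ?d)"
    using R pos by (auto simp: eta1_star_def eta2_star_def R_p_def R_n_def field_simps)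
  then have X: "?r * ?c * (eta1_star S)\<^sup>2 = ?a * ?m" and Y: "?r * ?d * (eta2_star S)\<^sup>2 = ?b * ?m"
    using pos by auto
  \<comment> \<open>These are the bar values before the cut at 1. In the squared equation for
    \<open>x0\<close> the correction factor replaces \<open>R_0\<close> by \<open>R_0 + p_fn\<close>
    and the mean low cost by its sum with \<open>c_n\<close>, which is stationarity on the edge
    where the second probability is 1; \<open>y0\<close> is symmetric.\<close>
  define x0 where "x0 = eta1_star S / sqrt ((1 + ?b / ?r) / (1 + ?d / ?m))"
  define y0 where "y0 = eta2_star S / sqrt ((1 + ?a / ?r) / (1 + ?c / ?m))"
  have bar: "eta1_bar S = min 1 x0" "eta2_bar S = min 1 y0"
    by (simp_all add: eta1_bar_def eta2_bar_def x0_def y0_def)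
  have ratio: "0 < (1 + ?b / ?r) / (1 + ?d / ?m)" "0 < (1 + ?a / ?r) / (1 + ?c / ?m)"
    using pos by (auto intro!: divide_pos_pos add_pos_pos)
  have x0: "0 < x0" and y0: "0 < y0" unfolding x0_def y0_def using star_pos ratio by auto
  have "x0\<^sup>2 = ?a * ?m / (?r * ?c) / ((1 + ?b / ?r) / (1 + ?d / ?m))"
    using ratio by (simp add: x0_def power_divide star_sq)
  also have "\<dots> = ?a * (?m + ?d) / ((?r + ?b) * ?c)"
    using pos by (simp add: divide_simps)
  finally have x0_eq: "(?r + ?b) * ?c * x0\<^sup>2 = ?a * (?m + ?d)" using pos by simp
  have "y0\<^sup>2 = ?b * ?m / (?r * ?d) / ((1 + ?a / ?r) / (1 + ?c / ?m))"
    using ratio by (simp add: y0_def power_divide star_sq)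
  also have "\<dots> = ?b * (?m + ?c) / ((?r + ?a) * ?d)"
    using pos by (simp add: divide_simps)
  finally have y0_eq: "(?r + ?a) * ?d * y0\<^sup>2 = ?b * (?m + ?c)" using pos by simp
  show ?thesis
  proof (intro conjI impI)
    assume le: "max (R_p S) (R_n S) \<le> ?r"
    then show in_box: "eta1_star S \<in> {0<..1}" "eta2_star S \<in> {0<..1}" using star_pos star_le by auto
    show "efficiency_maximisers S = {(eta1_star S, eta2_star S)}"
    proof (rule efficiency_maximisers_eq_singleton[OF _ _ _ phi_pos])
      fix x y :: real
      assume "x \<in> {0<..1}" "y \<in> {0<..1}" "(x, y) \<noteq> (eta1_star S, eta2_star S)"
      then show "case_prod (phi S) (eta1_star S, eta2_star S) < phi S x y"
        unfolding phi case_prod_conv using pos star_pos X Y by (intro cost_prod_gt_star) auto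
    qed (use in_box pos in auto)
  next
    assume gt: "max (R_p S) (R_n S) > ?r"
    then show out: "eta1_star S > 1 \<or> eta2_star S > 1" using star_le by (auto simp: less_max_iff_disj not_le[symmetric])
    define p where "p = (if phi S 1 (eta2_bar S) \<le> phi S (eta1_bar S) 1
               then (1, eta2_bar S) else (eta1_bar S, 1))"
    show "efficiency_maximisers S = {p}"
    proof (rule efficiency_maximisers_eq_singleton[OF _ _ _ phi_pos])
      fix x y :: real
      assume "x \<in> {0<..1}" "y \<in> {0<..1}" "(x, y) \<noteq> p"
      then show "case_prod (phi S) p < phi S x y"
        unfolding phi using pos star_pos X Y x0 x0_eq y0 y0_eq out
        by (intro cost_prod_constrained_min[where X = "eta1_star S" and Y = "eta2_star S" and ?x0.0 = x0 and ?y0.0 = y0])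
          (auto simp: less_max_iff_disj p_def phi bar)
    qed (use pos x0 y0 in \<open>auto simp: p_def bar\<close>)
  qed
qed

end
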